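(* Let $A=\begin{pmatrix} a & b\\ c& d\end{pmatrix}$ be a $2\times 2$ $q$-quantum matrix, let $\delta=ad-qbc$, let $C=\begin{pmatrix} q^{1/2} & 0\\ 0& q^{-1/2}\end{pmatrix}$, and put $\tau=q^{1/2}a+q^{-1/2}d$ and $\tau'=q^{-1/2}a+q^{1/2}d$. Then for every positive integer $n$, $$A^{n}=AC^{-n+1}f_{n-1}(\tau)-C^{-n}\delta f_{n-2}(\tau)=f_{n-1}(\tau')C^{n-1}A-f_{n-2}(\tau')\delta C^{n},$$ where $f_{-1}(\tau)=f_{-1}(\tau')=0$ and, for $n\ge 0$ and $x\in\{\tau,\tau'\}$, $$f_{n}(x)=f_n(x,\delta)=\sum_{l=0}^{\lfloor n/2\rfloor}(-1)^{l}\binom{n-l}{l}x^{n-2l}\delta^{l}.$$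
   Context: Let $k$ be a fixed base field and let $q$ be a central indeterminate, with a central invertible square root $q^{1/2}$ (inverse $q^{-1/2}$) adjoined. A $2\times 2$ ($q$-)quantum matrix is a matrix $A=\begin{pmatrix} a & b\\ c& d\end{pmatrix}$ whose entries satisfy the relations $$ab=qba,\quad ac=qca,\quad ad-da=(q-q^{-1})bc,\quad bc=cb,\quad bd=qdb,\quad cd=qdc.$$ The ambient (noncommutative) algebra is $\mathcal{A}_q(Mat(2))$, the algebra generated by $a,b,c,d$ and $q$ with these relations (with $q^{\pm 1/2}$ adjoined). The quantum determinant is $\delta=ad-qbc=da-q^{-1}bc$, which is a central element of this algebra. A product of a matrix with an element of the algebra (such as $f_{n-1}(\tau)$) on the right, respectively on the left, means multiplying every entry by that element on the right, respectively on the left. *)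

theory Defs
  imports "HOL-Analysis.Cartesian_Space"
begin

section \<open>The algebra of quantum matrices\<close>

text \<open>
  The algebra \<open>A\<^sub>q(Mat(2))\<close> over a field, with central \<open>q\<^sup>1\<^sup>/\<^sup>2\<close> and \<open>q\<^sup>-\<^sup>1\<^sup>/\<^sup>2\<close> adjoined, is given by
  generators and relations: terms over the generators and the scalars, modulo the least
  congruence containing the axioms of a unital associative algebra, the centrality and mutual
  inversion of the two roots, and the defining relations. The indeterminate \<open>q\<close> is the square
  of \<open>q\<^sup>1\<^sup>/\<^sup>2\<close>; no relation other than those listed is imposed on it.
\<close>

datatype qgen = GenA | GenB | GenC | GenD | RootQ | RootQInv

datatype 'k qterm =
    Scal 'k
  | Gen qgen
  | Add "'k qterm" "'k qterm"
  | Mul "'k qterm" "'k qterm"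

abbreviation (input) term_q :: "'k qterm" where
  "term_q \<equiv> Mul (Gen RootQ) (Gen RootQ)"

abbreviation (input) term_qinv :: "'k qterm" where
  "term_qinv \<equiv> Mul (Gen RootQInv) (Gen RootQInv)"

text \<open>The relation \<open>ad - da = (q - q\<^sup>-\<^sup>1) b c\<close> is written as \<open>ad + q\<^sup>-\<^sup>1 b c = da + q b c\<close>.\<close>

inductive qterm_eq :: "'k::field qterm \<Rightarrow> 'k qterm \<Rightarrow> bool" where
  refl: "qterm_eq x x"
| sym: "qterm_eq x y \<Longrightarrow> qterm_eq y x"
| trans: "qterm_eq x y \<Longrightarrow> qterm_eq y z \<Longrightarrow> qterm_eq x z"
| add_cong: "qterm_eq x x' \<Longrightarrow> qterm_eq y y' \<Longrightarrow> qterm_eq (Add x y) (Add x' y')"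
| mul_cong: "qterm_eq x x' \<Longrightarrow> qterm_eq y y' \<Longrightarrow> qterm_eq (Mul x y) (Mul x' y')"
| add_assoc: "qterm_eq (Add (Add x y) z) (Add x (Add y z))"
| add_comm: "qterm_eq (Add x y) (Add y x)"
| add_zero: "qterm_eq (Add (Scal 0) x) x"
| add_neg: "qterm_eq (Add (Mul (Scal (- 1)) x) x) (Scal 0)"
| mul_assoc: "qterm_eq (Mul (Mul x y) z) (Mul x (Mul y z))"
| mul_one: "qterm_eq (Mul (Scal 1) x) x"
| distrib_left: "qterm_eq (Mul x (Add y z)) (Add (Mul x y) (Mul x z))"
| distrib_right: "qterm_eq (Mul (Add x y) z) (Add (Mul x z) (Mul y z))"
| scal_add: "qterm_eq (Scal (r + s)) (Add (Scal r) (Scal s))"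
| scal_mul: "qterm_eq (Scal (r * s)) (Mul (Scal r) (Scal s))"
| scal_central: "qterm_eq (Mul (Scal r) x) (Mul x (Scal r))"
| root_central: "qterm_eq (Mul (Gen RootQ) x) (Mul x (Gen RootQ))"
| root_inv_central: "qterm_eq (Mul (Gen RootQInv) x) (Mul x (Gen RootQInv))"
| root_inv: "qterm_eq (Mul (Gen RootQ) (Gen RootQInv)) (Scal 1)"
| rel_ab: "qterm_eq (Mul (Gen GenA) (Gen GenB)) (Mul term_q (Mul (Gen GenB) (Gen GenA)))"
| rel_ac: "qterm_eq (Mul (Gen GenA) (Gen GenC)) (Mul term_q (Mul (Gen GenC) (Gen GenA)))"
| rel_ad: "qterm_eq
    (Add (Mul (Gen GenA) (Gen GenD)) (Mul term_qinv (Mul (Gen GenB) (Gen GenC))))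
    (Add (Mul (Gen GenD) (Gen GenA)) (Mul term_q (Mul (Gen GenB) (Gen GenC))))"
| rel_bc: "qterm_eq (Mul (Gen GenB) (Gen GenC)) (Mul (Gen GenC) (Gen GenB))"
| rel_bd: "qterm_eq (Mul (Gen GenB) (Gen GenD)) (Mul term_q (Mul (Gen GenD) (Gen GenB)))"
| rel_cd: "qterm_eq (Mul (Gen GenC) (Gen GenD)) (Mul term_q (Mul (Gen GenD) (Gen GenC)))"

quotient_type (overloaded) 'k qmat_alg = "'k::field qterm" / qterm_eq
  by (intro equivpI reflpI sympI transpI) (blast intro: qterm_eq.intros)+

text \<open>
  Evaluation of terms in a ring in which the relations hold. Every relation is respected, so the
  quotient maps to each such ring; in particular it maps to the base field (the roots going to
  \<open>1\<close> and the four generators to \<open>0\<close>), hence \<open>0 \<noteq> 1\<close>.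
\<close>

primrec qterm_eval :: "('k \<Rightarrow> 'r::ring_1) \<Rightarrow> (qgen \<Rightarrow> 'r) \<Rightarrow> 'k qterm \<Rightarrow> 'r" where
  "qterm_eval h g (Scal r) = h r"
| "qterm_eval h g (Gen x) = g x"
| "qterm_eval h g (Add x y) = qterm_eval h g x + qterm_eval h g y"
| "qterm_eval h g (Mul x y) = qterm_eval h g x * qterm_eval h g y"

lemma qterm_eval_cong:
  fixes h :: "'k::field \<Rightarrow> 'r::ring_1" and g :: "qgen \<Rightarrow> 'r"
  assumes "qterm_eq x y"
    and "\<And>r s. h (r + s) = h r + h s" "\<And>r s. h (r * s) = h r * h s" "h 1 = 1"
    and "\<And>r z. h r * z = z * h r"
    and "\<And>z. g RootQ * z = z * g RootQ" "\<And>z. g RootQInv * z = z * g RootQInv"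
    and "g RootQ * g RootQInv = 1"
    and "g GenA * g GenB = g RootQ * g RootQ * (g GenB * g GenA)"
    and "g GenA * g GenC = g RootQ * g RootQ * (g GenC * g GenA)"
    and "g GenA * g GenD + g RootQInv * g RootQInv * (g GenB * g GenC)
         = g GenD * g GenA + g RootQ * g RootQ * (g GenB * g GenC)"
    and "g GenB * g GenC = g GenC * g GenB"
    and "g GenB * g GenD = g RootQ * g RootQ * (g GenD * g GenB)"
    and "g GenC * g GenD = g RootQ * g RootQ * (g GenD * g GenC)"
  shows "qterm_eval h g x = qterm_eval h g y"
proof -
  have h0: "h 0 = 0" using assms(2)[of 0 0] by simp
  have h1: "h (- 1) = - 1" using assms(2)[of "- 1" 1] h0 assms(4) by (simp add: eq_neg_iff_add_eq_0)
  show ?thesis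
    using assms(1)
  proof (induction rule: qterm_eq.induct)
    case scal_central show ?case by (simp add: assms(5))
  next
    case root_central show ?case by (simp add: assms(6))
  next
    case root_inv_central show ?case by (simp add: assms(7))
  next
    case rel_ad show ?case using assms(11) by simp
  qed (simp_all add: h0 h1 assms(2,3,4,8-10,12-14) algebra_simps)
qed

lemma qterm_zero_neq_one: "\<not> qterm_eq (Scal 0) (Scal (1 :: 'k::field))"
proof
  assume "qterm_eq (Scal 0) (Scal (1 :: 'k))"
  then have "qterm_eval id (case_qgen 0 0 0 0 1 1) (Scal 0 :: 'k qterm)
      = qterm_eval id (case_qgen 0 0 0 0 1 1) (Scal 1)"
    by (rule qterm_eval_cong) simp_all
  then show False by simp
qed

instantiation qmat_alg :: (field) ring_1
begin

lift_definition zero_qmat_alg :: "'a qmat_alg" is "Scal 0" .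
lift_definition one_qmat_alg :: "'a qmat_alg" is "Scal 1" .
lift_definition plus_qmat_alg :: "'a qmat_alg \<Rightarrow> 'a qmat_alg \<Rightarrow> 'a qmat_alg" is Add
  by (rule qterm_eq.add_cong)
lift_definition times_qmat_alg :: "'a qmat_alg \<Rightarrow> 'a qmat_alg \<Rightarrow> 'a qmat_alg" is Mul
  by (rule qterm_eq.mul_cong)
lift_definition uminus_qmat_alg :: "'a qmat_alg \<Rightarrow> 'a qmat_alg" is "Mul (Scal (- 1))"
  by (rule qterm_eq.mul_cong[OF qterm_eq.refl])
definition minus_qmat_alg :: "'a qmat_alg \<Rightarrow> 'a qmat_alg \<Rightarrow> 'a qmat_alg" where
  "minus_qmat_alg x y = x + - y"

instance
proof
  fix x y z :: "'a qmat_alg"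
  show "x + y + z = x + (y + z)" by transfer (rule qterm_eq.add_assoc)
  show "x + y = y + x" by transfer (rule qterm_eq.add_comm)
  show "0 + x = x" by transfer (rule qterm_eq.add_zero)
  show "- x + x = 0" by transfer (rule qterm_eq.add_neg)
  show "x - y = x + - y" by (rule minus_qmat_alg_def)
  show "x * y * z = x * (y * z)" by transfer (rule qterm_eq.mul_assoc)
  show "1 * x = x" by transfer (rule qterm_eq.mul_one)
  show "x * 1 = x" by transfer (blast intro: qterm_eq.intros)
  show "(x + y) * z = x * z + y * z" by transfer (rule qterm_eq.distrib_right)
  show "x * (y + z) = x * y + x * z" by transfer (rule qterm_eq.distrib_left)
  show "(0 :: 'a qmat_alg) \<noteq> 1" by transfer (rule qterm_zero_neq_one)
qed

end

lift_definition scalar :: "'k::field \<Rightarrow> 'k qmat_alg" is Scal .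
lift_definition gen_a :: "'k::field qmat_alg" is "Gen GenA" .
lift_definition gen_b :: "'k::field qmat_alg" is "Gen GenB" .
lift_definition gen_c :: "'k::field qmat_alg" is "Gen GenC" .
lift_definition gen_d :: "'k::field qmat_alg" is "Gen GenD" .
lift_definition q_half :: "'k::field qmat_alg" is "Gen RootQ" .
lift_definition q_neg_half :: "'k::field qmat_alg" is "Gen RootQInv" .

definition qq :: "'k::field qmat_alg" where "qq = q_half * q_half"
definition qq_inv :: "'k::field qmat_alg" where "qq_inv = q_neg_half * q_neg_half"

lemma scalar_hom:
  "scalar 0 = 0" "scalar 1 = 1"
  "scalar (r + s) = scalar r + scalar s" "scalar (r * s) = scalar r * scalar s"
  by (transfer, blast intro: qterm_eq.intros)+

lemma scalar_central: "scalar r * x = x * scalar r"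
  by transfer (rule qterm_eq.scal_central)

lemma q_half_central: "q_half * x = x * q_half"
  by transfer (rule qterm_eq.root_central)

lemma q_neg_half_central: "q_neg_half * x = x * q_neg_half"
  by transfer (rule qterm_eq.root_inv_central)

lemma q_half_inverse: "q_half * q_neg_half = 1" "q_neg_half * q_half = 1"
proof -
  show 1: "q_half * q_neg_half = 1" by transfer (rule qterm_eq.root_inv)
  show "q_neg_half * q_half = 1" using 1 by (simp add: q_neg_half_central)
qed

section \<open>Matrices\<close>

definition mat2 :: "'a::zero \<Rightarrow> 'a \<Rightarrow> 'a \<Rightarrow> 'a \<Rightarrow> 'a^2^2" where
  "mat2 a b c d = vector [vector [a, b], vector [c, d]]"

primrec mat_pow :: "'a::semiring_1^'n^'n \<Rightarrow> nat \<Rightarrow> 'a^'n^'n" where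
  "mat_pow M 0 = mat 1"
| "mat_pow M (Suc n) = M ** mat_pow M n"

definition mat_powi :: "'a::semiring_1^'n^'n \<Rightarrow> int \<Rightarrow> 'a^'n^'n" where
  "mat_powi M k = (if k \<ge> 0 then mat_pow M (nat k) else mat_pow (matrix_inv M) (nat (- k)))"

definition entries_mult_right :: "'a::times^'n^'m \<Rightarrow> 'a \<Rightarrow> 'a^'n^'m" (infixl "*r" 70) where
  "M *r x = (\<chi> i j. M $ i $ j * x)"

definition entries_mult_left :: "'a::times \<Rightarrow> 'a^'n^'m \<Rightarrow> 'a^'n^'m" (infixr "*l" 70) where
  "x *l M = (\<chi> i j. x * M $ i $ j)"

definition quantum_matrix :: "'k::field qmat_alg^2^2 \<Rightarrow> bool" where
  "quantum_matrix A \<longleftrightarrow>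
    (let a = A $ 1 $ 1; b = A $ 1 $ 2; c = A $ 2 $ 1; d = A $ 2 $ 2 in
      a * b = qq * b * a \<and> a * c = qq * c * a \<and> a * d - d * a = (qq - qq_inv) * b * c \<and>
      b * c = c * b \<and> b * d = qq * d * b \<and> c * d = qq * d * c)"

definition matrix_C :: "'k::field qmat_alg^2^2" where
  "matrix_C = mat2 q_half 0 0 q_neg_half"

lemma mat2_nth [simp]:
  "mat2 a b c d $ 1 $ 1 = a" "mat2 a b c d $ 1 $ 2 = b"
  "mat2 a b c d $ 2 $ 1 = c" "mat2 a b c d $ 2 $ 2 = d"
  by (simp_all add: mat2_def)

lemma quantum_matrix_generic: "quantum_matrix (mat2 gen_a gen_b gen_c gen_d)"
proof -
  have ad: "gen_a * gen_d + qq_inv * (gen_b * gen_c) = gen_d * gen_a + qq * (gen_b * gen_c)"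
    unfolding qq_def qq_inv_def by transfer (rule qterm_eq.rel_ad)
  have "gen_a * gen_b = qq * (gen_b * gen_a)" "gen_a * gen_c = qq * (gen_c * gen_a)"
    "gen_b * gen_c = gen_c * gen_b" "gen_b * gen_d = qq * (gen_d * gen_b)"
    "gen_c * gen_d = qq * (gen_d * gen_c)"
    unfolding qq_def
    by (transfer, rule qterm_eq.rel_ab qterm_eq.rel_ac qterm_eq.rel_bc qterm_eq.rel_bd
        qterm_eq.rel_cd)+
  moreover have "gen_a * gen_d - gen_d * gen_a = (qq - qq_inv) * (gen_b * gen_c)"
    using ad by (simp add: left_diff_distrib diff_eq_eq add.commute add_diff_eq eq_diff_eq)
  ultimately show ?thesis
    by (simp add: quantum_matrix_def mult.assoc)
qed

lemma matrix_C_inverse: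
  "matrix_C ** mat2 q_neg_half 0 0 q_half = mat 1"
  "mat2 q_neg_half 0 0 q_half ** matrix_C = mat 1"
  by (simp_all add: matrix_C_def matrix_matrix_mult_def mat_def vec_eq_iff forall_2 sum_2
      q_half_inverse)

lemma matrix_inv_matrix_C:
  "(matrix_inv matrix_C :: 'k::field qmat_alg^2^2) = mat2 q_neg_half 0 0 q_half"
proof -
  let ?B = "mat2 q_neg_half 0 0 q_half :: 'k::field qmat_alg^2^2"
  let ?I = "matrix_inv matrix_C :: 'k qmat_alg^2^2"
  have "matrix_C ** ?I = mat 1 \<and> ?I ** matrix_C = mat 1"
    unfolding matrix_inv_def by (rule someI[of _ ?B]) (simp add: matrix_C_inverse)
  then have "?I = (?B ** matrix_C) ** ?I" "matrix_C ** ?I = mat 1"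
    by (simp_all add: matrix_C_inverse)
  then show ?thesis
    by (metis matrix_mul_assoc matrix_mul_rid)
qed

section \<open>The polynomials \<open>f\<^sub>n\<close>\<close>

text \<open>The index is an integer, with value \<open>0\<close> at negative indices, to allow for \<open>f\<^sub>-\<^sub>1 = 0\<close>.\<close>

definition f_poly :: "int \<Rightarrow> 'a::ring_1 \<Rightarrow> 'a \<Rightarrow> 'a" where
  "f_poly n x \<delta> = (if n < 0 then 0 else
    (\<Sum>l = 0..nat n div 2.
      (- 1) ^ l * of_nat ((nat n - l) choose l) * x ^ (nat n - 2 * l) * \<delta> ^ l))"

end

theory Submission
  imports Defs
begin

text \<open>
  The theorem is a Cayley-Hamilton theorem followed by the usual passage from a quadratic equation
  to a formula for all powers. A quantum matrix satisfies the two twisted characteristic equations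
  \<open>A\<^sup>2 = A C\<^sup>-\<^sup>1 \<tau> - C\<^sup>-\<^sup>2 \<delta>\<close> (\<open>square_right\<close>) and \<open>A\<^sup>2 = \<tau>' C A - \<delta> C\<^sup>2\<close> (\<open>square_left\<close>): the trace is
  replaced by \<open>\<tau>\<close> or \<open>\<tau>'\<close>, and the twist by \<open>C\<close> absorbs the powers of \<open>q\<close> that arise when the
  off-diagonal entries are moved past \<open>a\<close> and \<open>d\<close>.

  Suppose \<open>D\<close> has entries that commute with \<open>t\<close> and \<open>\<delta>\<close>, and \<open>A\<^sup>2 = A D t - D\<^sup>2 \<delta>\<close>. Multiplying
  \<open>A\<^sup>n\<^sup>+\<^sup>1 = A D\<^sup>n f\<^sub>n - D\<^sup>n\<^sup>+\<^sup>1 \<delta> f\<^sub>n\<^sub>-\<^sub>1\<close> by \<open>A\<close> from the left and replacing \<open>A\<^sup>2\<close> gives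
  \<open>A\<^sup>n\<^sup>+\<^sup>2 = A D\<^sup>n\<^sup>+\<^sup>1 (t f\<^sub>n - \<delta> f\<^sub>n\<^sub>-\<^sub>1) - D\<^sup>n\<^sup>+\<^sup>2 \<delta> f\<^sub>n\<close>, and \<open>t f\<^sub>n - \<delta> f\<^sub>n\<^sub>-\<^sub>1\<close> is \<open>f\<^sub>n\<^sub>+\<^sub>1\<close>: the \<open>f\<^sub>n\<close> are
  rescaled Chebyshev polynomials of the second kind, which obey this recurrence (\<open>f_poly_recurrence\<close>) as soon
  as \<open>t\<close> commutes with \<open>\<delta>\<close>. The other formula is the mirror image, obtained by multiplying by \<open>A\<close>
  from the right. Here \<open>D\<close> is \<open>C\<^sup>-\<^sup>1\<close> in one case and \<open>C\<close> in the other; both are diagonal with powers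
  of \<open>q\<^sup>1\<^sup>/\<^sup>2\<close> on the diagonal, so their entries are central. The remaining input is that the quantum
  determinant commutes with \<open>a\<close> and \<open>d\<close> (\<open>quantum_det_commute\<close>).
\<close>

section \<open>The recurrence of the polynomials\<close>

text \<open>
  For \<open>l > n/2\<close> the binomial coefficient vanishes, so the summation range can be lengthened to one
  that involves no division; this spares the recurrence a case distinction on the parity of \<open>n\<close>.
\<close>

lemma f_poly_nat:
  fixes x \<delta> :: "'a::ring_1"
  shows "f_poly (int n) x \<delta> =
    (\<Sum>l\<le>n. (- 1) ^ l * of_nat ((n - l) choose l) * x ^ (n - 2 * l) * \<delta> ^ l)"
proof -
  have "(\<Sum>l\<le>n. (- 1) ^ l * of_nat ((n - l) choose l) * x ^ (n - 2 * l) * \<delta> ^ l) =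
    (\<Sum>l = 0..n div 2. (- 1) ^ l * of_nat ((n - l) choose l) * x ^ (n - 2 * l) * \<delta> ^ l)"
  proof (rule sum.mono_neutral_right)
    show "\<forall>l\<in>{..n} - {0..n div 2}.
      (- 1) ^ l * of_nat ((n - l) choose l) * x ^ (n - 2 * l) * \<delta> ^ l = 0"
    proof
      fix l assume "l \<in> {..n} - {0..n div 2}"
      then have "n - l < l" by auto
      then show "(- 1) ^ l * of_nat ((n - l) choose l) * x ^ (n - 2 * l) * \<delta> ^ l = 0"
        by (simp add: binomial_eq_0)
    qed
  qed auto
  then show ?thesis by (simp add: f_poly_def)
qed

lemma f_poly_minus_one [simp]: "f_poly (- 1) x \<delta> = 0"
  by (simp add: f_poly_def)

lemma f_poly_zero [simp]: "f_poly 0 x \<delta> = 1"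
  by (simp add: f_poly_def)

lemma f_poly_commute:
  fixes x \<delta> :: "'a::ring_1"
  assumes "y * x = x * y" and "y * \<delta> = \<delta> * y"
  shows "y * f_poly k x \<delta> = f_poly k x \<delta> * y"
proof -
  have mult: "y * (u * v) = u * v * y" if "y * u = u * y" "y * v = v * y" for u v
    using that by (metis mult.assoc)
  have "y * ((- 1) ^ l) = (- 1) ^ l * y" for l
    by (cases "even l") simp_all
  moreover have "y * x ^ i = x ^ i * y" "y * \<delta> ^ i = \<delta> ^ i * y" for i
    using assms by (metis power_commuting_commutes)+
  ultimately have "y * ((- 1) ^ l * of_nat m * x ^ i * \<delta> ^ j)
      = (- 1) ^ l * of_nat m * x ^ i * \<delta> ^ j * y" for l m i j
    by (intro mult) (simp_all add: mult_of_nat_commute)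
  then show ?thesis
    by (simp add: f_poly_def sum_distrib_left sum_distrib_right)
qed

text \<open>
  This is Pascal's rule: moving \<open>x\<close> and \<open>\<delta>\<close> into the sums, the coefficient of
  \<open>x\<^sup>n\<^sup>+\<^sup>1\<^sup>-\<^sup>2\<^sup>l \<delta>\<^sup>l\<close> in \<open>f\<^sub>n\<^sub>+\<^sub>1\<close> is the sum of those from \<open>x f\<^sub>n\<close> (index \<open>l\<close>) and from \<open>- \<delta> f\<^sub>n\<^sub>-\<^sub>1\<close>
  (index \<open>l - 1\<close>).
\<close>

lemma f_poly_recurrence:
  fixes x \<delta> :: "'a::ring_1"
  assumes comm: "x * \<delta> = \<delta> * x"
  shows "f_poly (int n + 1) x \<delta> = x * f_poly (int n) x \<delta> - \<delta> * f_poly (int n - 1) x \<delta>"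
proof (cases n)
  case 0
  then show ?thesis by (simp add: f_poly_def)
next
  case (Suc m)
  let ?c = "\<lambda>l k. (- 1) ^ l * of_nat k :: 'a"
  let ?e = "\<lambda>l. x ^ (m + 2 - 2 * l) * \<delta> ^ l"
  have central: "y * ?c l k = ?c l k * y" for y :: 'a and l k
    by (cases "even l") (simp_all add: mult_of_nat_commute)
  \<comment> \<open>All three sums are brought to the range of \<open>f\<^sub>m\<close>, with the term of index \<open>0\<close> split off where
    it exists, so that they can be compared term by term.\<close>
  have F0: "\<delta> * f_poly (int m) x \<delta> = - (\<Sum>l\<le>m. ?c (Suc l) ((m - l) choose l) * ?e (Suc l))"
  proof -
    have "\<delta> * (?c l k * x ^ i * \<delta> ^ l) = - (?c (Suc l) k * (x ^ i * \<delta> ^ Suc l))" for l k i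
    proof -
      have "\<delta> * (?c l k * x ^ i * \<delta> ^ l) = ?c l k * (\<delta> * x ^ i * \<delta> ^ l)"
        using central[of \<delta> l k] by (metis mult.assoc)
      also have "\<delta> * x ^ i = x ^ i * \<delta>"
        using power_commuting_commutes[OF comm, of i] by simp
      finally show ?thesis by (simp add: mult.assoc)
    qed
    then show ?thesis
      by (simp add: f_poly_nat sum_distrib_left sum_negf)
  qed
  have F1: "x * f_poly (int (Suc m)) x \<delta> =
      ?e 0 + (\<Sum>l\<le>m. ?c (Suc l) ((m - l) choose Suc l) * ?e (Suc l))"
  proof -
    have "x * (?c l ((m + 1 - l) choose l) * x ^ (m + 1 - 2 * l) * \<delta> ^ l)
        = ?c l ((m + 1 - l) choose l) * ?e l" for l
      \<comment> \<open>If \<open>2 * l\<close> exceeds \<open>m + 1\<close>, the truncated exponent on the left does not grow when \<open>x\<close> is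
        multiplied in, but then the coefficient is zero.\<close>
    proof (cases "2 * l \<le> m + 1")
      case True
      then have "m + 2 - 2 * l = Suc (m + 1 - 2 * l)" by simp
      moreover have "x * (?c l k * x ^ i * \<delta> ^ l) = ?c l k * (x ^ Suc i * \<delta> ^ l)" for k i
        using central[of x l k] by (metis mult.assoc power_Suc)
      ultimately show ?thesis by simp
    next
      case False
      then have "m + 1 - l < l" by simp
      then show ?thesis by (simp add: binomial_eq_0)
    qed
    then have "x * f_poly (int (Suc m)) x \<delta> = (\<Sum>l\<le>Suc m. ?c l ((m + 1 - l) choose l) * ?e l)"
      by (simp only: f_poly_nat sum_distrib_left Suc_eq_plus1)
    then show ?thesis
      by (simp only: sum.atMost_Suc_shift) simp
  qed
  have F2: "f_poly (int (m + 2)) x \<delta> =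
      ?e 0 + (\<Sum>l\<le>m. ?c (Suc l) ((m + 1 - l) choose Suc l) * ?e (Suc l))"
  proof -
    have "f_poly (int (m + 2)) x \<delta> = (\<Sum>l\<le>Suc (Suc m). ?c l ((m + 2 - l) choose l) * ?e l)"
      by (simp only: f_poly_nat mult.assoc) simp
    also have "\<dots> = (\<Sum>l\<le>Suc m. ?c l ((m + 2 - l) choose l) * ?e l)"
      by (subst sum.atMost_Suc) simp
    finally show ?thesis
      by (simp only: sum.atMost_Suc_shift) simp
  qed
  have "?c (Suc l) ((m + 1 - l) choose Suc l) * ?e (Suc l) =
      ?c (Suc l) ((m - l) choose Suc l) * ?e (Suc l) + ?c (Suc l) ((m - l) choose l) * ?e (Suc l)"
    if "l \<le> m" for l
    using that by (simp add: Suc_diff_le ring_distribs)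
  then have pascal: "(\<Sum>l\<le>m. ?c (Suc l) ((m + 1 - l) choose Suc l) * ?e (Suc l)) =
      (\<Sum>l\<le>m. ?c (Suc l) ((m - l) choose Suc l) * ?e (Suc l))
      + (\<Sum>l\<le>m. ?c (Suc l) ((m - l) choose l) * ?e (Suc l))"
    by (simp only: sum.distrib[symmetric]) (rule sum.cong; simp)
  have "f_poly (int (m + 2)) x \<delta> = x * f_poly (int (Suc m)) x \<delta> - \<delta> * f_poly (int m) x \<delta>"
    unfolding F0 F1 F2 pascal by (simp only: diff_minus_eq_add add.assoc)
  moreover have "int n + 1 = int (m + 2)" "int n - 1 = int m" "int n = int (Suc m)"
    using Suc by simp_all
  ultimately show ?thesis by metis
qed

section \<open>Matrices over a noncommutative ring\<close>

lemma entries_mult_right_nth [simp]: "(M *r x) $ i $ j = M $ i $ j * x"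
  by (simp add: entries_mult_right_def)

lemma entries_mult_left_nth [simp]: "(x *l M) $ i $ j = x * M $ i $ j"
  by (simp add: entries_mult_left_def)

lemma matrix_mult_nth: "(M ** N) $ i $ j = (\<Sum>k\<in>UNIV. M $ i $ k * N $ k $ j)"
  by (simp add: matrix_matrix_mult_def)

lemma matrix_mult_entries_mult_right:
  fixes M :: "'a::ring_1^'n^'m" and N :: "'a^'p^'n"
  shows "M ** (N *r x) = (M ** N) *r x"
  by (simp add: vec_eq_iff matrix_mult_nth sum_distrib_right mult.assoc)

lemma entries_mult_left_matrix_mult:
  fixes M :: "'a::ring_1^'n^'m" and N :: "'a^'p^'n"
  shows "(x *l M) ** N = x *l (M ** N)"
  by (simp add: vec_eq_iff matrix_mult_nth sum_distrib_left mult.assoc)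

lemma entries_mult_right_matrix_mult:
  fixes M :: "'a::ring_1^'n^'m" and N :: "'a^'p^'n"
  assumes "\<And>i j. N $ i $ j * x = x * N $ i $ j"
  shows "(M *r x) ** N = (M ** N) *r x"
  by (simp add: vec_eq_iff matrix_mult_nth sum_distrib_right mult.assoc assms)

lemma matrix_mult_entries_mult_left:
  fixes M :: "'a::ring_1^'n^'m" and N :: "'a^'p^'n"
  assumes "\<And>i j. M $ i $ j * x = x * M $ i $ j"
  shows "M ** (x *l N) = x *l (M ** N)"
  by (simp add: vec_eq_iff matrix_mult_nth sum_distrib_left assms flip: mult.assoc)

lemma matrix_diff_mult:
  fixes M M' :: "'a::ring_1^'n^'m" and N :: "'a^'p^'n"
  shows "(M - M') ** N = M ** N - M' ** N"
  by (simp add: vec_eq_iff matrix_mult_nth left_diff_distrib sum_subtractf)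

lemma matrix_mult_diff:
  fixes M :: "'a::ring_1^'n^'m" and N N' :: "'a^'p^'n"
  shows "M ** (N - N') = M ** N - M ** N'"
  by (simp add: vec_eq_iff matrix_mult_nth right_diff_distrib sum_subtractf)

lemma mat_pow_Suc_right:
  fixes M :: "'a::semiring_1^'n^'n"
  shows "mat_pow M (Suc n) = mat_pow M n ** M"
  by (induction n) (simp_all add: matrix_mul_assoc)

lemma mat_pow_entries_commute:
  fixes D :: "'a::ring_1^'n^'n"
  assumes "\<And>i j. D $ i $ j * x = x * D $ i $ j"
  shows "mat_pow D n $ i $ j * x = x * mat_pow D n $ i $ j"
proof (induction n arbitrary: i j)
  case 0
  then show ?case by (simp add: mat_def)
next
  case (Suc n)
  have "D $ i $ k * mat_pow D n $ k $ j * x = x * (D $ i $ k * mat_pow D n $ k $ j)" for k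
    using Suc assms[of i k] by (metis mult.assoc)
  then show ?case
    by (simp add: matrix_mult_nth sum_distrib_left sum_distrib_right)
qed

text \<open>
  The two lemmas below turn a twisted quadratic equation into a formula for the powers. The twist
  \<open>D\<close> need not commute with \<open>A\<close>; what makes the induction work is that the powers of \<open>D\<close> stay on
  one side of \<open>A\<close> and the coefficients \<open>t\<close> and \<open>\<delta>\<close> can be pulled out past \<open>D\<close>.
\<close>

lemma mat_pow_eq_f_poly_right:
  fixes A D :: "'a::ring_1^'n^'n"
  assumes D_t: "\<And>i j. D $ i $ j * t = t * D $ i $ j"
    and D_\<delta>: "\<And>i j. D $ i $ j * \<delta> = \<delta> * D $ i $ j"
    and t_\<delta>: "t * \<delta> = \<delta> * t"
    and square: "A ** A = (A ** D) *r t - (D ** D) *r \<delta>"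
  shows "mat_pow A (Suc n) = (A ** mat_pow D n) *r f_poly (int n) t \<delta>
    - (mat_pow D (Suc n) *r \<delta>) *r f_poly (int n - 1) t \<delta>"
proof (induction n)
  case 0
  then show ?case by (simp add: vec_eq_iff)
next
  case (Suc n)
  let ?f = "\<lambda>k. f_poly k t \<delta>"
  have "A ** (A ** mat_pow D n) = (A ** A) ** mat_pow D n"
    by (simp add: matrix_mul_assoc)
  also have "\<dots> = (A ** mat_pow D (Suc n)) *r t - mat_pow D (Suc (Suc n)) *r \<delta>"
    unfolding square matrix_diff_mult
    by (simp add: entries_mult_right_matrix_mult mat_pow_entries_commute D_t D_\<delta> matrix_mul_assoc)
  finally have step: "A ** (A ** mat_pow D n)
      = (A ** mat_pow D (Suc n)) *r t - mat_pow D (Suc (Suc n)) *r \<delta>" .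
  have "mat_pow A (Suc (Suc n)) = A ** mat_pow A (Suc n)"
    by simp
  also have "\<dots> = (A ** (A ** mat_pow D n)) *r ?f n
      - ((A ** mat_pow D (Suc n)) *r \<delta>) *r ?f (int n - 1)"
    unfolding Suc.IH matrix_mult_diff matrix_mult_entries_mult_right ..
  also have "\<dots> = (A ** mat_pow D (Suc n)) *r (t * ?f n - \<delta> * ?f (int n - 1))
      - (mat_pow D (Suc (Suc n)) *r \<delta>) *r ?f n"
    unfolding step by (simp add: vec_eq_iff algebra_simps)
  also have "t * ?f n - \<delta> * ?f (int n - 1) = ?f (int (Suc n))"
    using f_poly_recurrence[OF t_\<delta>, of n] by (simp add: add.commute)
  finally show ?case by simp
qed

text \<open>
  Here \<open>A\<close> is split off on the right, which produces the recurrence in the form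
  \<open>f\<^sub>n t - f\<^sub>n\<^sub>-\<^sub>1 \<delta>\<close>; it agrees with the earlier one because \<open>f\<^sub>n\<close> commutes with \<open>t\<close> and \<open>\<delta>\<close>.
\<close>

lemma mat_pow_eq_f_poly_left:
  fixes A D :: "'a::ring_1^'n^'n"
  assumes D_t: "\<And>i j. D $ i $ j * t = t * D $ i $ j"
    and D_\<delta>: "\<And>i j. D $ i $ j * \<delta> = \<delta> * D $ i $ j"
    and t_\<delta>: "t * \<delta> = \<delta> * t"
    and square: "A ** A = t *l (D ** A) - \<delta> *l (D ** D)"
  shows "mat_pow A (Suc n) = f_poly (int n) t \<delta> *l (mat_pow D n ** A)
    - f_poly (int n - 1) t \<delta> *l (\<delta> *l mat_pow D (Suc n))"
proof (induction n)
  case 0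
  then show ?case by (simp add: vec_eq_iff)
next
  case (Suc n)
  let ?f = "\<lambda>k. f_poly k t \<delta>"
  have "(mat_pow D n ** A) ** A = mat_pow D n ** (A ** A)"
    by (simp add: matrix_mul_assoc)
  also have "\<dots> = t *l (mat_pow D (Suc n) ** A) - \<delta> *l mat_pow D (Suc (Suc n))"
    unfolding square matrix_mult_diff mat_pow_Suc_right
    by (simp add: matrix_mult_entries_mult_left mat_pow_entries_commute D_t D_\<delta> matrix_mul_assoc)
  finally have step: "(mat_pow D n ** A) ** A
      = t *l (mat_pow D (Suc n) ** A) - \<delta> *l mat_pow D (Suc (Suc n))" .
  have "mat_pow A (Suc (Suc n)) = mat_pow A (Suc n) ** A"
    by (rule mat_pow_Suc_right)
  also have "\<dots> = ?f n *l ((mat_pow D n ** A) ** A)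
      - ?f (int n - 1) *l (\<delta> *l (mat_pow D (Suc n) ** A))"
    unfolding Suc.IH matrix_diff_mult entries_mult_left_matrix_mult ..
  also have "\<dots> = (?f n * t - ?f (int n - 1) * \<delta>) *l (mat_pow D (Suc n) ** A)
      - ?f n *l (\<delta> *l mat_pow D (Suc (Suc n)))"
    unfolding step by (simp add: vec_eq_iff algebra_simps)
  also have "?f n * t - ?f (int n - 1) * \<delta> = ?f (int (Suc n))"
    using f_poly_recurrence[OF t_\<delta>, of n] f_poly_commute[OF HOL.refl t_\<delta>, of n]
      f_poly_commute[OF t_\<delta>[symmetric] HOL.refl, of "int n - 1"]
    by (simp add: add.commute)
  finally show ?case by simp
qed

section \<open>Quantum matrices\<close>

context
  fixes a b c d \<delta> :: "'k::field qmat_alg"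
  assumes quantum: "quantum_matrix (mat2 a b c d)"
    and \<delta>_def: "\<delta> = a * d - qq * b * c"
begin

text \<open>
  Oriented from left to right, the relations sort every monomial: the roots of \<open>q\<close> come first, then
  the entries in the order \<open>d\<close>, \<open>b\<close>, \<open>c\<close>, \<open>a\<close>. The rules in \<open>straighten_left\<close> apply the same
  rewriting inside right-nested products. An identity between polynomials in the entries is then
  checked by comparing the sorted forms of both sides.
\<close>

lemma straighten:
  "a * b = q_half * (q_half * (b * a))" "a * c = q_half * (q_half * (c * a))"
  "b * d = q_half * (q_half * (d * b))" "c * d = q_half * (q_half * (d * c))"
  "c * b = b * c"
  "a * d = d * a + q_half * (q_half * (b * c)) - q_neg_half * (q_neg_half * (b * c))"
proof -
  show "c * b = b * c"
    using quantum by (simp add: quantum_matrix_def Let_def)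
  have "a * d - d * a = (qq - qq_inv) * b * c"
    using quantum by (simp add: quantum_matrix_def Let_def)
  then have "a * d = d * a + (qq - qq_inv) * b * c"
    by (simp add: algebra_simps)
  then show "a * d = d * a + q_half * (q_half * (b * c)) - q_neg_half * (q_neg_half * (b * c))"
    by (simp add: qq_def qq_inv_def mult.assoc left_diff_distrib)
qed (use quantum in \<open>simp_all add: quantum_matrix_def Let_def qq_def mult.assoc\<close>)

lemma straighten_left:
  "a * (b * x) = q_half * (q_half * (b * (a * x)))" "a * (c * x) = q_half * (q_half * (c * (a * x)))"
  "b * (d * x) = q_half * (q_half * (d * (b * x)))" "c * (d * x) = q_half * (q_half * (d * (c * x)))"
  "c * (b * x) = b * (c * x)"
  "a * (d * x) = d * (a * x) + q_half * (q_half * (b * (c * x)))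
    - q_neg_half * (q_neg_half * (b * (c * x)))"
  using straighten[THEN arg_cong, of "\<lambda>y. y * x"]
  by (simp_all only: mult.assoc ring_distribs)

lemma roots_to_front:
  "y * q_half = q_half * y" "y * q_neg_half = q_neg_half * y"
  "y * (q_half * x) = q_half * (y * x)" "y * (q_neg_half * x) = q_neg_half * (y * x)"
  by (metis mult.assoc q_half_central q_neg_half_central)+

lemma roots_cancel:
  "q_half * (q_neg_half * x) = x" "q_neg_half * (q_half * x) = x"
  by (simp_all add: q_half_inverse flip: mult.assoc)

lemmas normalise = straighten straighten_left roots_cancel q_half_inverse
  roots_to_front[where y = a] roots_to_front[where y = b]
  roots_to_front[where y = c] roots_to_front[where y = d]
  mult.assoc ring_distribs

text \<open>
  This is the sorted form of the determinant; the defining one has \<open>a\<close> and \<open>d\<close> in the wrong order.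
\<close>

lemma quantum_det: "\<delta> = d * a - q_neg_half * (q_neg_half * (b * c))"
  by (simp add: \<delta>_def qq_def normalise)

lemma quantum_det_commute: "a * \<delta> = \<delta> * a" "d * \<delta> = \<delta> * d"
  by (simp_all add: quantum_det normalise)

text \<open>
  The coefficients \<open>r\<close> and \<open>s\<close> are arbitrary central elements, to cover both \<open>\<tau>\<close> and \<open>\<tau>'\<close>.
\<close>

lemma quantum_trace_commute:
  assumes "\<And>y. r * y = y * r" and "\<And>y. s * y = y * s"
  shows "(r * a + s * d) * \<delta> = \<delta> * (r * a + s * d)"
proof -
  have "r * a * \<delta> = \<delta> * (r * a)" "s * d * \<delta> = \<delta> * (s * d)"
    using assms quantum_det_commute by (metis mult.assoc)+
  then show ?thesis by (simp only: ring_distribs)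
qed

text \<open>
  In the entry at \<open>(1,1)\<close> the product \<open>a q\<^sup>-\<^sup>1\<^sup>/\<^sup>2 \<tau> = a\<^sup>2 + q\<^sup>-\<^sup>1 a d\<close> exceeds \<open>a\<^sup>2 + b c\<close> by
  \<open>q\<^sup>-\<^sup>1 a d - b c = q\<^sup>-\<^sup>1 \<delta>\<close>; the entry at \<open>(2,2)\<close> uses \<open>\<delta> = d a - q\<^sup>-\<^sup>1 b c\<close> in the same way. Off
  the diagonal the twist gives exactly the factor that reorders the product, for instance
  \<open>b q\<^sup>1\<^sup>/\<^sup>2 \<tau> = q b a + b d = a b + b d\<close>.
\<close>

lemma square_right:
  "mat2 a b c d ** mat2 a b c d =
    (mat2 a b c d ** mat2 q_neg_half 0 0 q_half) *r (q_half * a + q_neg_half * d)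
    - (mat2 q_neg_half 0 0 q_half ** mat2 q_neg_half 0 0 q_half) *r \<delta>"
  by (simp add: vec_eq_iff forall_2 matrix_mult_nth sum_2 quantum_det normalise)

lemma square_left:
  "mat2 a b c d ** mat2 a b c d =
    (q_neg_half * a + q_half * d) *l (matrix_C ** mat2 a b c d)
    - \<delta> *l (matrix_C ** matrix_C)"
  by (simp add: vec_eq_iff forall_2 matrix_mult_nth sum_2 quantum_det matrix_C_def normalise)

end

lemma diagonal_root_central:
  assumes "r \<in> {q_half, q_neg_half}" and "s \<in> {q_half, q_neg_half}"
  shows "mat2 r 0 0 s $ i $ j * y = y * mat2 r 0 0 s $ i $ j"
  using assms exhaust_2[of i] exhaust_2[of j]
  by (auto simp: q_half_central[of y] q_neg_half_central[of y])

theorem theorem1p1: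
  fixes a b c d \<delta> \<tau> \<tau>' :: "'k::field qmat_alg"
    and A C :: "'k qmat_alg^2^2"
    and n :: nat
  assumes "A = mat2 a b c d" and "quantum_matrix A"
    and "\<delta> = a * d - qq * b * c"
    and "C = matrix_C"
    and "\<tau> = q_half * a + q_neg_half * d"
    and "\<tau>' = q_neg_half * a + q_half * d"
    and "n \<ge> 1"
  shows "mat_pow A n =
          (A ** mat_powi C (- int n + 1)) *r f_poly (int n - 1) \<tau> \<delta>
            - (mat_powi C (- int n) *r \<delta>) *r f_poly (int n - 2) \<tau> \<delta> \<and>
         mat_pow A n =
          f_poly (int n - 1) \<tau>' \<delta> *l (mat_powi C (int n - 1) ** A)
            - f_poly (int n - 2) \<tau>' \<delta> *l (\<delta> *l mat_powi C (int n))"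
proof -
  obtain m where n: "n = Suc m" using assms(7) by (cases n) simp_all
  have quantum: "quantum_matrix (mat2 a b c d)" using assms(1,2) by simp
  let ?D = "mat2 q_neg_half 0 0 q_half :: 'k qmat_alg^2^2"
  have powi: "mat_powi C (- int n + 1) = mat_pow ?D m" "mat_powi C (- int n) = mat_pow ?D (Suc m)"
    "mat_powi C (int m) = mat_pow C m" "mat_powi C (int n) = mat_pow C (Suc m)"
    by (simp_all add: n mat_powi_def assms(4) matrix_inv_matrix_C nat_add_distrib)
  have index: "int n - 1 = int m" "int n - 2 = int m - 1"
    by (simp_all add: n)
  note trace_commute = quantum_trace_commute[OF quantum assms(3)]
  have "mat_pow A (Suc m) = (A ** mat_pow ?D m) *r f_poly (int m) \<tau> \<delta>
      - (mat_pow ?D (Suc m) *r \<delta>) *r f_poly (int m - 1) \<tau> \<delta>"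
  proof (rule mat_pow_eq_f_poly_right)
    show "\<tau> * \<delta> = \<delta> * \<tau>"
      unfolding assms(5) by (rule trace_commute) (rule q_half_central q_neg_half_central)+
    show "A ** A = (A ** ?D) *r \<tau> - (?D ** ?D) *r \<delta>"
      unfolding assms(1,5) by (rule square_right[OF quantum assms(3)])
  qed (rule diagonal_root_central; simp)+
  moreover have "mat_pow A (Suc m) = f_poly (int m) \<tau>' \<delta> *l (mat_pow C m ** A)
      - f_poly (int m - 1) \<tau>' \<delta> *l (\<delta> *l mat_pow C (Suc m))"
  proof (rule mat_pow_eq_f_poly_left)
    show "\<tau>' * \<delta> = \<delta> * \<tau>'"
      unfolding assms(6) by (rule trace_commute) (rule q_half_central q_neg_half_central)+
    show "A ** A = \<tau>' *l (C ** A) - \<delta> *l (C ** C)"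
      unfolding assms(1,4,6) by (rule square_left[OF quantum assms(3)])
  qed (unfold assms(4) matrix_C_def, (rule diagonal_root_central; simp)+)
  ultimately show ?thesis
    unfolding index powi by (simp only: n)
qed

end
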